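(* Let $m\le M$ be real numbers, let $x_1,\dots,x_n$ be real numbers with $m\le x_i\le M$ for $i=1,\dots,n$, and let $p_1,\dots,p_n\ge 0$ with $\sum_{i=1}^n p_i=1$. Let $\mu_1'=\sum_{i=1}^n p_i x_i$, $\mu_3'=\sum_{i=1}^n p_i x_i^3$, and $\mu_r=\sum_{i=1}^n p_i(x_i-\mu_1')^r$ for $r=2,3$. Then $$-\frac{4}{27}(\mu_1'-m)^5\le \mu_2\mu_3\le \frac{4}{27}(M-\mu_1')^5,$$ $$\frac14 m^2(m+3\mu_1')\le \mu_3'\le \frac14 M^2(M+3\mu_1'),$$ $$-\frac14(\mu_1'-m)^3\le \mu_3\le \frac14 (M-\mu_1')^3,$$ and, if in addition $m>0$ (so that $0<m\le x_i\le M$ for all $i$), $$\mu_3\ge \frac{\mu_2-(\mu_1')^2}{\mu_1'}\,\mu_2.$$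
   Context: The numbers $x_i$ are the values of a discrete random variable, taken with probabilities $p_i$; $\mu_r'$ is its $r$-th moment about the origin and $\mu_r$ its $r$-th central moment. *)

theory Defs
  imports Complex_Main
begin

definition raw_moment :: "nat \<Rightarrow> (nat \<Rightarrow> real) \<Rightarrow> (nat \<Rightarrow> real) \<Rightarrow> nat \<Rightarrow> real" where
  "raw_moment n p x r = (\<Sum>i = 1..n. p i * x i ^ r)"

definition central_moment :: "nat \<Rightarrow> (nat \<Rightarrow> real) \<Rightarrow> (nat \<Rightarrow> real) \<Rightarrow> nat \<Rightarrow> real" where
  "central_moment n p x r = (\<Sum>i = 1..n. p i * (x i - raw_moment n p x 1) ^ r)"

end

theory Submission
  imports Defs
begin

text \<open>Every bound is the mean of a pointwise inequality \<open>(M - x) * (x + c)\<^sup>2 \<ge> 0\<close> with a suitable shift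
  \<open>c\<close>; the lower bounds are the upper bounds for \<open>-x\<close>. The choice \<open>c = M / 2\<close> cancels the quadratic term.
  For a centred variable bounded above by \<open>b > 0\<close>, the optimal choice \<open>c = \<mu>2 / b\<close> gives
  \<open>\<mu>3 \<le> b * \<mu>2 - \<mu>2\<^sup>2 / b\<close>, and maximising \<open>\<mu>2 * (b * \<mu>2 - \<mu>2\<^sup>2 / b)\<close> over \<open>\<mu>2\<close> gives \<open>4 / 27 * b ^ 5\<close>
  at \<open>\<mu>2 = 2 / 3 * b\<^sup>2\<close>.\<close>

text \<open>The factor \<open>(y i + c)\<^sup>2\<close> is nonnegative for either sign of
  \<open>c\<close>, so the shift stays free and each use picks its own: \<open>b / 2\<close>,
  \<open>s / b\<close> or \<open>0\<close>.\<close>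

lemma weighted_cubic_bound:
  fixes p y :: "'a \<Rightarrow> real"
  assumes p: "\<And>i. i \<in> A \<Longrightarrow> 0 \<le> p i" and y: "\<And>i. i \<in> A \<Longrightarrow> y i \<le> b"
  shows "(\<Sum>i\<in>A. p i * y i ^ 3) \<le> (b - 2 * c) * (\<Sum>i\<in>A. p i * (y i)\<^sup>2)
    + (2 * b * c - c\<^sup>2) * (\<Sum>i\<in>A. p i * y i) + b * c\<^sup>2 * (\<Sum>i\<in>A. p i)"
proof -
  have "0 \<le> (\<Sum>i\<in>A. p i * ((b - y i) * (y i + c)\<^sup>2))"
    using p y by (intro sum_nonneg mult_nonneg_nonneg) auto
  also have "\<dots> = (\<Sum>i\<in>A. (b - 2 * c) * (p i * (y i)\<^sup>2) + (2 * b * c - c\<^sup>2) * (p i * y i)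
      + b * c\<^sup>2 * p i - p i * y i ^ 3)"
    by (intro sum.cong refl) (simp add: algebra_simps power2_eq_square power3_eq_cube)
  finally show ?thesis
    by (simp add: sum.distrib sum_subtractf sum_distrib_left)
qed

text \<open>The shift \<open>c = b / 2\<close> leaves only the mean and a constant, with
  coefficients \<open>3 / 4 * b\<^sup>2\<close> and \<open>b ^ 3 / 4\<close>. No sign of
  \<open>b\<close> is assumed, so reflected variables are covered too.\<close>

lemma third_moment_le:
  fixes p y :: "'a \<Rightarrow> real"
  assumes "\<And>i. i \<in> A \<Longrightarrow> 0 \<le> p i" and "\<And>i. i \<in> A \<Longrightarrow> y i \<le> b" and "(\<Sum>i\<in>A. p i) = 1"
  shows "(\<Sum>i\<in>A. p i * y i ^ 3) \<le> 1 / 4 * b\<^sup>2 * (b + 3 * (\<Sum>i\<in>A. p i * y i))"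
  using weighted_cubic_bound[of A p y b "b / 2"] assms
  by (simp add: algebra_simps power2_eq_square)

lemma weighted_mean_le:
  fixes p y :: "'a \<Rightarrow> real"
  assumes "\<And>i. i \<in> A \<Longrightarrow> 0 \<le> p i" and "\<And>i. i \<in> A \<Longrightarrow> y i \<le> b" and "(\<Sum>i\<in>A. p i) = 1"
  shows "(\<Sum>i\<in>A. p i * y i) \<le> b"
proof -
  have "(\<Sum>i\<in>A. p i * y i) \<le> (\<Sum>i\<in>A. p i * b)"
    using assms by (intro sum_mono mult_left_mono) auto
  also have "\<dots> = b" using assms(3) by (simp flip: sum_distrib_right)
  finally show ?thesis .
qed

text \<open>With total weight 1 and mean 0, the cubic bound becomes
  \<open>(b - 2 * c) * s + b * c\<^sup>2\<close>, a quadratic in \<open>c\<close> with its minimum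
  at \<open>c = s / b\<close>.\<close>

lemma centered_third_moment_le:
  fixes p y :: "'a \<Rightarrow> real"
  assumes p: "\<And>i. i \<in> A \<Longrightarrow> 0 \<le> p i" and y: "\<And>i. i \<in> A \<Longrightarrow> y i \<le> b"
    and s1: "(\<Sum>i\<in>A. p i) = 1" and s0: "(\<Sum>i\<in>A. p i * y i) = 0" and b: "0 < b"
  shows "(\<Sum>i\<in>A. p i * y i ^ 3)
    \<le> b * (\<Sum>i\<in>A. p i * (y i)\<^sup>2) - (\<Sum>i\<in>A. p i * (y i)\<^sup>2)\<^sup>2 / b"
proof -
  define s where "s = (\<Sum>i\<in>A. p i * (y i)\<^sup>2)"
  have "(\<Sum>i\<in>A. p i * y i ^ 3) \<le> (b - 2 * (s / b)) * s + b * (s / b)\<^sup>2"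
    using weighted_cubic_bound[of A p y b "s / b"] p y s1 s0 unfolding s_def by simp
  also have "\<dots> = b * s - s\<^sup>2 / b"
    using b by (simp add: field_simps power2_eq_square)
  finally show ?thesis unfolding s_def .
qed

lemma centered_moment_product_le:
  fixes p y :: "'a \<Rightarrow> real"
  assumes p: "\<And>i. i \<in> A \<Longrightarrow> 0 \<le> p i" and y: "\<And>i. i \<in> A \<Longrightarrow> y i \<le> b"
    and s1: "(\<Sum>i\<in>A. p i) = 1" and s0: "(\<Sum>i\<in>A. p i * y i) = 0"
  shows "(\<Sum>i\<in>A. p i * (y i)\<^sup>2) * (\<Sum>i\<in>A. p i * y i ^ 3) \<le> 4 / 27 * b ^ 5"
proof -
  define s where "s = (\<Sum>i\<in>A. p i * (y i)\<^sup>2)"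
  define t where "t = (\<Sum>i\<in>A. p i * y i ^ 3)"
  have s: "0 \<le> s" unfolding s_def using p by (intro sum_nonneg) auto
  \<comment> \<open>The mean, here 0, cannot exceed the upper bound \<open>b\<close>.\<close>
  have b: "0 \<le> b" using weighted_mean_le[of A p y b] p y s1 s0 by simp
  show ?thesis
  proof (cases "b = 0")
    case True
    have "t \<le> 0"
      using weighted_cubic_bound[of A p y b 0] p y s0 True unfolding t_def by simp
    then have "s * t \<le> 0" using s by (simp add: mult_nonneg_nonpos)
    then show ?thesis using True unfolding s_def t_def by simp
  next
    case False
    with b have b: "0 < b" by simp
    have "t \<le> b * s - s\<^sup>2 / b"
      unfolding s_def t_def by (rule centered_third_moment_le[OF p y s1 s0 b])
    then have "s * t \<le> s * (b * s - s\<^sup>2 / b)"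
      using s by (rule mult_left_mono)
    \<comment> \<open>The gap to the maximum, multiplied by \<open>b\<close>, is a cubic in
      \<open>s\<close> with a double root at the maximiser \<open>2 / 3 * b\<^sup>2\<close> and a
      simple root at \<open>- b\<^sup>2 / 3\<close>. Hence it is nonnegative for
      \<open>s \<ge> 0\<close>.\<close>
    also have "\<dots> = 4 / 27 * b ^ 5 - (s - 2 / 3 * b\<^sup>2)\<^sup>2 * (s + b\<^sup>2 / 3) / b"
      using b by (simp add: field_simps eval_nat_numeral)
    also have "\<dots> \<le> 4 / 27 * b ^ 5"
      using b s by simp
    finally show ?thesis unfolding s_def t_def .
  qed
qed

theorem theorem2p7:
  fixes m M :: real and n :: nat and x p :: "nat \<Rightarrow> real"
  assumes "m \<le> M"
    and "\<And>i. i \<in> {1..n} \<Longrightarrow> m \<le> x i \<and> x i \<le> M"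
    and "\<And>i. i \<in> {1..n} \<Longrightarrow> 0 \<le> p i"
    and "(\<Sum>i = 1..n. p i) = 1"
  defines "\<mu>1' \<equiv> raw_moment n p x 1"
    and "\<mu>3' \<equiv> raw_moment n p x 3"
    and "\<mu>2 \<equiv> central_moment n p x 2"
    and "\<mu>3 \<equiv> central_moment n p x 3"
  shows "(- (4 / 27) * (\<mu>1' - m) ^ 5 \<le> \<mu>2 * \<mu>3 \<and> \<mu>2 * \<mu>3 \<le> 4 / 27 * (M - \<mu>1') ^ 5) \<and>
    (1 / 4 * m\<^sup>2 * (m + 3 * \<mu>1') \<le> \<mu>3' \<and> \<mu>3' \<le> 1 / 4 * M\<^sup>2 * (M + 3 * \<mu>1')) \<and>
    (- (1 / 4) * (\<mu>1' - m) ^ 3 \<le> \<mu>3 \<and> \<mu>3 \<le> 1 / 4 * (M - \<mu>1') ^ 3) \<and>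
    (0 < m \<longrightarrow> \<mu>3 \<ge> (\<mu>2 - \<mu>1'\<^sup>2) / \<mu>1' * \<mu>2)"
proof -
  note bounds = assms(2) and p = assms(3) and p1 = assms(4)
  have \<mu>1: "\<mu>1' = (\<Sum>i = 1..n. p i * x i)"
    and \<mu>3': "\<mu>3' = (\<Sum>i = 1..n. p i * x i ^ 3)"
    and \<mu>2: "\<mu>2 = (\<Sum>i = 1..n. p i * (x i - \<mu>1')\<^sup>2)"
    and \<mu>3: "\<mu>3 = (\<Sum>i = 1..n. p i * (x i - \<mu>1') ^ 3)"
    by (simp_all add: \<mu>1'_def \<mu>3'_def \<mu>2_def \<mu>3_def raw_moment_def central_moment_def)
  have s0: "(\<Sum>i = 1..n. p i * (x i - \<mu>1')) = 0"
    using p1 \<mu>1 by (simp add: right_diff_distrib sum_subtractf flip: sum_distrib_right)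
  \<comment> \<open>Reflection about the mean: \<open>\<mu>1' - x i\<close> is centred and bounded
    above by \<open>\<mu>1' - m\<close>, has the same second moment and the negated third. Upper
    bounds for it are lower bounds for \<open>\<mu>3\<close>.\<close>
  have s0': "(\<Sum>i = 1..n. p i * (\<mu>1' - x i)) = 0"
    using p1 \<mu>1 by (simp add: right_diff_distrib sum_subtractf flip: sum_distrib_right)
  have \<mu>2': "(\<Sum>i = 1..n. p i * (\<mu>1' - x i)\<^sup>2) = \<mu>2"
    by (simp add: \<mu>2 power2_commute)
  have cube: "(\<mu>1' - x i) ^ 3 = - ((x i - \<mu>1') ^ 3)" for i
    by (simp add: power3_eq_cube algebra_simps)
  have \<mu>3m: "(\<Sum>i = 1..n. p i * (\<mu>1' - x i) ^ 3) = - \<mu>3"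
    by (simp add: cube \<mu>3 sum_negf)
  have up: "x i - \<mu>1' \<le> M - \<mu>1'" and lo: "\<mu>1' - x i \<le> \<mu>1' - m" and "- x i \<le> - m"
    if "i \<in> {1..n}" for i
    using bounds[OF that] by auto
  have 1: "\<mu>2 * \<mu>3 \<le> 4 / 27 * (M - \<mu>1') ^ 5"
    using centered_moment_product_le[OF p up p1 s0] by (simp add: \<mu>2 \<mu>3)
  have 2: "- (4 / 27) * (\<mu>1' - m) ^ 5 \<le> \<mu>2 * \<mu>3"
    using centered_moment_product_le[OF p lo p1 s0'] unfolding \<mu>2' \<mu>3m by simp
  have 3: "\<mu>3' \<le> 1 / 4 * M\<^sup>2 * (M + 3 * \<mu>1')"
    using third_moment_le[of "{1..n}" p x M] bounds p p1 by (simp add: \<mu>3' \<mu>1)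
  have 4: "1 / 4 * m\<^sup>2 * (m + 3 * \<mu>1') \<le> \<mu>3'"
    using third_moment_le[of "{1..n}" p "\<lambda>i. - x i" "- m"] bounds p p1
    by (simp add: \<mu>3' \<mu>1 sum_negf algebra_simps)
  \<comment> \<open>For the centred variable the mean term drops out, leaving a quarter of the cube
    of the bound.\<close>
  have 5: "\<mu>3 \<le> 1 / 4 * (M - \<mu>1') ^ 3"
    using third_moment_le[of "{1..n}" p "\<lambda>i. x i - \<mu>1'", OF p up p1] unfolding s0 \<mu>3[symmetric]
    by (simp add: power2_eq_square power3_eq_cube)
  have 6: "- (1 / 4) * (\<mu>1' - m) ^ 3 \<le> \<mu>3"
    using third_moment_le[of "{1..n}" p "\<lambda>i. \<mu>1' - x i", OF p lo p1] unfolding s0' \<mu>3m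
    by (simp add: power2_eq_square power3_eq_cube)
  have 7: "\<mu>3 \<ge> (\<mu>2 - \<mu>1'\<^sup>2) / \<mu>1' * \<mu>2" if m: "0 < m"
  proof -
    have "- \<mu>1' \<le> - m"
      using weighted_mean_le[of "{1..n}" p "\<lambda>i. - x i" "- m"] bounds p p1
      by (simp add: \<mu>1 sum_negf)
    with m have pos: "0 < \<mu>1'" by simp
    \<comment> \<open>Positivity of \<open>x i\<close> allows \<open>b = \<mu>1'\<close> as the
      bound of the reflected variable; this choice yields exactly the stated quotient by
      \<open>\<mu>1'\<close>.\<close>
    have "\<mu>1' - x i \<le> \<mu>1'" if "i \<in> {1..n}" for i
      using bounds[OF that] m by simp
    from centered_third_moment_le[OF p this p1 s0' pos]
    have "- \<mu>3 \<le> \<mu>1' * \<mu>2 - \<mu>2\<^sup>2 / \<mu>1'" unfolding \<mu>2' \<mu>3m by simp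
    then show ?thesis using pos by (simp add: field_simps power2_eq_square)
  qed
  show ?thesis using 1 2 3 4 5 6 7 by blast
qed

end
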